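(* Let $n\ge 1$ and $k$ be integers with $\lfloor n/2\rfloor \le k\le \lfloor (2n-2)/3\rfloor$. Then the graphs $\Phi^n_k$, $A_{2n-3k-2,\,2k-n+1}$ and $\Pi_{2n-3k-2,\,2k-n+1}$ are pairwise isomorphic: $$\Phi^n_k\cong A_{2n-3k-2,\,2k-n+1}\cong \Pi_{2n-3k-2,\,2k-n+1}.$$
   Context: A subword of a word is a block of consecutive letters. A binary word (over $\{0,1\}$) of length $n\ge 1$ is Padovan if it starts and ends with $0$, contains no subword $00$, and contains no subword $111$. For $n\ge1$ and $\lfloor n/2\rfloor\le k\le\lfloor(2n-2)/3\rfloor$, the weighted Padovan graph $\Phi^n_k$ is the simple graph whose vertices are all Padovan words of length $n$ with exactly $k$ letters $1$; two vertices are adjacent if one can be obtained from the other by replacing exactly one subword $01$ with $10$. For nonnegative integers $p,q$, the graph $A_{p,q}$ has as vertices all words of length $p+q$ over $\{a,b\}$ with exactly $p$ letters $a$ and $q$ letters $b$; two words are adjacent if one can be obtained from the other by changing one subword $ab$ to $ba$. For nonnegative integers $p,q$, the graph $\Pi_{p,q}$ has as vertices all integer sequences $(\lambda_1,\dots,\lambda_q)$ with $p\ge\lambda_1\ge\cdots\ge\lambda_q\ge 0$ (weak partitions into $q$ parts, parts $0$ allowed, with largest part at most $p$); two vertices are adjacent if one can be obtained from the other by adding $1$ to one of the parts. *)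

theory Defs
  imports "HOL-Library.Sublist" "HOL-Library.Z2" "Graph_Theory.Graph_Theory"
begin

(* A simple graph is represented, as in Graph_Theory, by a symmetric loop-free digraph without
   parallel arcs: an edge {u, v} is the pair of arcs (u, v) and (v, u). *)

definition adj_graph :: "'a set \<Rightarrow> ('a \<Rightarrow> 'a \<Rightarrow> bool) \<Rightarrow> 'a pair_pre_digraph" where
  "adj_graph V R =
     \<lparr> pverts = V, parcs = {(u, v). u \<in> V \<and> v \<in> V \<and> (R u v \<or> R v u)} \<rparr>"

definition replace_one :: "'a list \<Rightarrow> 'a list \<Rightarrow> 'a list \<Rightarrow> 'a list \<Rightarrow> bool" where
  "replace_one x y u v \<longleftrightarrow> (\<exists>s t. u = s @ x @ t \<and> v = s @ y @ t)"

definition padovan :: "bit list \<Rightarrow> bool" where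
  "padovan w \<longleftrightarrow> w \<noteq> [] \<and> hd w = 0 \<and> last w = 0 \<and>
     \<not> sublist [0, 0] w \<and> \<not> sublist [1, 1, 1] w"

definition padovan_graph :: "nat \<Rightarrow> nat \<Rightarrow> bit list pair_pre_digraph" where
  "padovan_graph n k =
     adj_graph {w. padovan w \<and> length w = n \<and> count_list w 1 = k} (replace_one [0, 1] [1, 0])"

datatype ab = LetterA | LetterB

definition ab_graph :: "nat \<Rightarrow> nat \<Rightarrow> ab list pair_pre_digraph" where
  "ab_graph p q =
     adj_graph {w. length w = p + q \<and> count_list w LetterA = p \<and> count_list w LetterB = q}
       (replace_one [LetterA, LetterB] [LetterB, LetterA])"

definition add_one :: "nat list \<Rightarrow> nat list \<Rightarrow> bool" where
  "add_one l m \<longleftrightarrow> (\<exists>i < length l. m = l[i := l ! i + 1])"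

definition partition_graph :: "nat \<Rightarrow> nat \<Rightarrow> nat list pair_pre_digraph" where
  "partition_graph p q =
     adj_graph {l. length l = q \<and> sorted_wrt (\<ge>) l \<and> (\<forall>x \<in> set l. x \<le> p)} add_one"

lemma pair_graph_adj_graph:
  assumes "finite V" and "\<And>u. u \<in> V \<Longrightarrow> \<not> R u u"
  shows "pair_graph (adj_graph V R)"
proof
  show "finite (parcs (adj_graph V R))"
    by (rule finite_subset[of _ "V \<times> V"]) (auto simp: adj_graph_def assms(1))
qed (use assms in \<open>auto simp: adj_graph_def symmetric_def sym_def\<close>)

lemma finite_lists_length:
  "finite {w :: 'a list. length w = n}" if "finite (UNIV :: 'a set)"
  using finite_lists_length_eq[OF that, of n] by simp

lemma pair_graph_padovan_graph: "pair_graph (padovan_graph n k)"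
proof -
  have "(UNIV :: bit set) = {0, 1}"
    by (auto intro: bit.exhaust)
  then have fin: "finite (UNIV :: bit set)"
    by (metis finite.emptyI finite.insertI)
  show ?thesis
    unfolding padovan_graph_def
    by (rule pair_graph_adj_graph, rule finite_subset[OF _ finite_lists_length[OF fin, of n]])
      (auto simp: replace_one_def)
qed

lemma pair_graph_ab_graph: "pair_graph (ab_graph p q)"
proof -
  have "(UNIV :: ab set) = {LetterA, LetterB}"
    by (auto intro: ab.exhaust)
  then have fin: "finite (UNIV :: ab set)"
    by (metis finite.emptyI finite.insertI)
  show ?thesis
    unfolding ab_graph_def
    by (rule pair_graph_adj_graph, rule finite_subset[OF _ finite_lists_length[OF fin, of "p + q"]])
      (auto simp: replace_one_def)
qed

lemma pair_graph_partition_graph: "pair_graph (partition_graph p q)"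
  unfolding partition_graph_def
proof (rule pair_graph_adj_graph)
  show "finite {l. length l = q \<and> sorted_wrt (\<ge>) l \<and> (\<forall>x \<in> set l. x \<le> p)}"
    by (rule finite_subset[OF _ finite_lists_length_eq[of "{..p}" q]]) auto
  show "\<not> add_one l l" for l
    unfolding add_one_def by (metis n_not_Suc_n nth_list_update_eq Suc_eq_plus1)
qed

end

(* Cutting a Padovan word after each 0 gives an initial 0 followed by blocks 10 and 110, whose
   multiplicities are forced by n and k; reading the blocks as letters a and b gives an ab-word.
   Under this coding, replacing 01 by 10 can only keep a word Padovan when it turns 10 110
   into 110 10, that is, ab into ba.  Recording for each b the number of letters a behind it turns
   an ab-word into a partition, and replacing ab by ba then adds one to a single part. *)
theory Submission
  imports Defs
begin

section \<open>Isomorphisms of graphs given by an adjacency relation\<close>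

text \<open>\<open>adj_graph\<close> symmetrizes its relation, so checking the oriented moves
  \<open>R\<close> and \<open>S\<close> on all ordered pairs already settles adjacency.\<close>

lemma digraph_iso_adj_graphI:
  assumes bij: "bij_betw f V W"
    and adj: "\<And>u v. u \<in> V \<Longrightarrow> v \<in> V \<Longrightarrow> R u v \<longleftrightarrow> S (f u) (f v)"
  shows "digraph_iso (with_proj (adj_graph V R)) (with_proj (adj_graph W S))"
proof -
  let ?G = "with_proj (adj_graph V R)"
  \<comment> \<open>Arcs are pairs of vertices, so the map on arcs is forced by
    \<open>f\<close>.\<close>
  let ?h = "\<lparr>iso_verts = f, iso_arcs = map_prod f f, iso_head = snd, iso_tail = fst\<rparr>"
  have inj: "inj_on f V" and im: "W = f ` V"
    using bij by (auto simp: bij_betw_def)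
  have "wf_digraph ?G"
    by unfold_locales (auto simp: adj_graph_def)
  moreover have "inj_on (map_prod f f) (parcs (adj_graph V R))"
    using inj by (auto simp: inj_on_def adj_graph_def)
  ultimately have "pre_digraph.digraph_isomorphism ?G ?h"
    using inj by (auto simp: pre_digraph.digraph_isomorphism_def adj_graph_def)
  moreover have "parcs (adj_graph W S) = map_prod f f ` parcs (adj_graph V R)"
  proof (intro set_eqI iffI)
    fix e assume "e \<in> parcs (adj_graph W S)"
    then obtain u v where "u \<in> V" "v \<in> V" "e = map_prod f f (u, v)" "S (f u) (f v) \<or> S (f v) (f u)"
      by (auto simp: adj_graph_def im)
    with adj show "e \<in> map_prod f f ` parcs (adj_graph V R)"
      by (intro image_eqI[of _ _ "(u, v)"]) (auto simp: adj_graph_def)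
  qed (auto simp: adj_graph_def im adj)
  then have "with_proj (adj_graph W S) = app_iso ?h ?G"
    by (auto simp: with_proj_def app_iso_def adj_graph_def im)
  ultimately show ?thesis
    unfolding digraph_iso_def by blast
qed

lemma bit_cases: "b = 0 \<or> b = (1 :: bit)"
  by (cases b) auto

section \<open>Padovan words\<close>

primrec padovan_block :: "ab \<Rightarrow> bit list" where
  "padovan_block LetterA = [1, 0]"
| "padovan_block LetterB = [1, 1, 0]"

text \<open>The initial 0 is split off so that the coding of the rest is a monoid
  homomorphism.\<close>

definition padovan_tail :: "ab list \<Rightarrow> bit list" where
  "padovan_tail x = concat (map padovan_block x)"

definition padovan_word :: "ab list \<Rightarrow> bit list" where
  "padovan_word x = 0 # padovan_tail x"

lemma padovan_tail_simps [simp]: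
  "padovan_tail [] = []"
  "padovan_tail (LetterA # x) = 1 # 0 # padovan_tail x"
  "padovan_tail (LetterB # x) = 1 # 1 # 0 # padovan_tail x"
  "padovan_tail (x @ y) = padovan_tail x @ padovan_tail y"
  by (simp_all add: padovan_tail_def)

text \<open>The blocks 10 and 110 form a prefix code: the second bit decides the first
  letter.\<close>

lemma inj_padovan_tail: "padovan_tail x = padovan_tail y \<Longrightarrow> x = y"
proof (induction x arbitrary: y)
  case Nil
  then show ?case
    by (cases y rule: list.exhaust; cases "hd y") auto
next
  case (Cons a x)
  then obtain b z where "y = b # z"
    by (cases y; cases a) auto
  with Cons show ?case
    by (cases a; cases b) auto
qed

lemma padovan_word_eq_iff [simp]: "padovan_word x = padovan_word y \<longleftrightarrow> x = y"
  by (auto simp: padovan_word_def dest: inj_padovan_tail)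

lemma length_padovan_word:
  "length (padovan_word x) = 1 + 2 * count_list x LetterA + 3 * count_list x LetterB"
proof -
  have "length (padovan_tail x) = 2 * count_list x LetterA + 3 * count_list x LetterB"
  proof (induction x)
    case (Cons a x)
    then show ?case by (cases a) auto
  qed simp
  then show ?thesis by (simp add: padovan_word_def)
qed

lemma count_padovan_word:
  "count_list (padovan_word x) 1 = count_list x LetterA + 2 * count_list x LetterB"
proof -
  have "count_list (padovan_tail x) 1 = count_list x LetterA + 2 * count_list x LetterB"
  proof (induction x)
    case (Cons a x)
    then show ?case by (cases a) auto
  qed simp
  then show ?thesis by (simp add: padovan_word_def)
qed

lemma length_eq_count_ab: "length x = count_list x LetterA + count_list x LetterB"
proof (induction x)
  case (Cons a x)
  then show ?case by (cases a) auto
qed simp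

text \<open>A new first letter puts 01 or 011 in front of a word that starts with 0, so neither 00
  nor 111 can arise at the join.\<close>

lemma padovan_padovan_word: "padovan (padovan_word x)"
proof (induction x)
  case Nil
  show ?case by (simp add: padovan_word_def padovan_def sublist_Cons_right)
next
  case (Cons a x)
  then show ?case
    by (cases a) (auto simp: padovan_word_def padovan_def sublist_Cons_right)
qed

text \<open>Both pieces keep the 0 at the cut: as subwords they avoid 00 and 111, and this 0
  supplies the missing end letter.\<close>

lemma padovan_appendD:
  assumes "padovan (s @ 0 # t)"
  shows "padovan (s @ [0])" and "padovan (0 # t)"
proof -
  have "sublist (s @ [0]) (s @ 0 # t)"
    by (metis append.assoc append_Cons append_Nil sublist_append_rightI)
  moreover have "sublist (0 # t) (s @ 0 # t)"
    by simp
  ultimately show "padovan (s @ [0])" "padovan (0 # t)"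
    using assms unfolding padovan_def
    by (auto simp: hd_append split: if_splits dest: sublist_order.order.trans)
qed

text \<open>Avoiding 00 and 111 forces 10 or 110 after the initial 0, unless the word ends there.
  The final 0 of that block starts a shorter Padovan word.\<close>

lemma padovan_wordE:
  assumes "padovan w"
  obtains x where "w = padovan_word x"
proof -
  have "\<exists>x. w = padovan_word x"
    using assms
  proof (induction w rule: length_induct)
    case (1 w)
    then obtain r where w: "w = 0 # r"
      by (cases w) (auto simp: padovan_def)
    show ?case
    proof (cases r)
      case Nil
      with w show ?thesis
        by (intro exI[of _ "[]"]) (simp add: padovan_word_def)
    next
      case (Cons b r1)
      with 1 w have b: "b = 1"
        using bit_cases[of b] by (auto simp: padovan_def sublist_Cons_right)
      with 1 w Cons obtain c r2 where r1: "r1 = c # r2"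
        by (cases r1) (auto simp: padovan_def)
      show ?thesis
      proof (cases "c = 0")
        case True
        with 1 w Cons b r1 have "padovan (0 # r2)"
          by (metis append_Cons append_Nil padovan_appendD(2))
        with 1 w Cons r1 True obtain x where "0 # r2 = padovan_word x"
          by (metis length_Cons less_Suc_eq_le le_SucI order.refl)
        with w Cons b r1 True show ?thesis
          by (intro exI[of _ "LetterA # x"]) (simp add: padovan_word_def)
      next
        case False
        then have c: "c = 1" using bit_cases[of c] by simp
        with 1 w Cons b r1 obtain d r3 where r2: "r2 = d # r3"
          by (cases r2) (auto simp: padovan_def)
        with 1 w Cons b r1 c have d: "d = 0"
          using bit_cases[of d] by (auto simp: padovan_def sublist_Cons_right)
        have w': "w = [0, 1, 1] @ 0 # r3"
          using w Cons b r1 c r2 d by simp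
        with 1 have "padovan (0 # r3)"
          by (metis padovan_appendD(2))
        with 1 w' obtain x where "0 # r3 = padovan_word x"
          by fastforce
        with w' show ?thesis
          by (intro exI[of _ "LetterB # x"]) (simp add: padovan_word_def)
      qed
    qed
  qed
  with that show ?thesis by blast
qed

text \<open>Any other neighbouring letter would create 00 or 111 in one of the two words, so the
  move is 0 10 110 to 0 110 10.\<close>

lemma replace_one_padovan_context:
  assumes "padovan (s @ [0, 1] @ t)" and "padovan (s @ [1, 0] @ t)"
  obtains s' t' where "s = s' @ [0, 1]" and "t = [1, 0] @ t'"
proof -
  \<comment> \<open>With \<open>s\<close> empty the second word would start with 1.\<close>
  from assms(2) obtain s1 b where s1: "s = s1 @ [b]"
    by (cases s rule: rev_cases) (auto simp: padovan_def)
  have "b \<noteq> 0"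
  proof
    assume "b = 0"
    with s1 have "s @ [0, 1] @ t = s1 @ [0, 0] @ (1 # t)"
      by simp
    with assms(1) show False
      unfolding padovan_def by (metis sublist_appendI)
  qed
  then have b: "b = 1" using bit_cases[of b] by simp
  \<comment> \<open>Otherwise the first word would start with \<open>b\<close>, which is 1.\<close>
  with assms(1) s1 obtain s2 c where s2: "s1 = s2 @ [c]"
    by (cases s1 rule: rev_cases) (auto simp: padovan_def)
  have "c \<noteq> 1"
  proof
    assume "c = 1"
    with s1 s2 b have "s @ [1, 0] @ t = s2 @ [1, 1, 1] @ (0 # t)"
      by simp
    with assms(2) show False
      unfolding padovan_def by (metis sublist_appendI)
  qed
  then have c: "c = 0" using bit_cases[of c] by simp
  \<comment> \<open>With \<open>t\<close> empty the first word would end in 1; the same argument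
    extends \<open>t1\<close> below.\<close>
  from assms(1) obtain d t1 where t1: "t = d # t1"
    by (cases t) (auto simp: padovan_def)
  have "d \<noteq> 0"
  proof
    assume "d = 0"
    with t1 have "s @ [1, 0] @ t = (s @ [1]) @ [0, 0] @ t1"
      by simp
    with assms(2) show False
      unfolding padovan_def by (metis sublist_appendI)
  qed
  then have d: "d = 1" using bit_cases[of d] by simp
  with assms(1) t1 obtain e t2 where t2: "t1 = e # t2"
    by (cases t1) (auto simp: padovan_def)
  have "e \<noteq> 1"
  proof
    assume "e = 1"
    with t1 t2 d have "s @ [0, 1] @ t = (s @ [0]) @ [1, 1, 1] @ t2"
      by simp
    with assms(1) show False
      unfolding padovan_def by (metis sublist_appendI)
  qed
  then have "e = 0" using bit_cases[of e] by simp
  with s1 s2 b c t1 t2 d show thesis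
    by (intro that[of s2 t2]) auto
qed

lemma replace_one_padovan_word_iff:
  "replace_one [LetterA, LetterB] [LetterB, LetterA] x y \<longleftrightarrow>
     replace_one [0, 1] [1, 0] (padovan_word x) (padovan_word y)"
proof
  assume "replace_one [LetterA, LetterB] [LetterB, LetterA] x y"
  then obtain s t where "x = s @ [LetterA, LetterB] @ t" "y = s @ [LetterB, LetterA] @ t"
    by (auto simp: replace_one_def)
  then show "replace_one [0, 1] [1, 0] (padovan_word x) (padovan_word y)"
    unfolding replace_one_def
    \<comment> \<open>The blocks 10 110 are read as 1 01 10; swapping the middle pair gives 1 10 10,
      that is, 110 10.\<close>
    by (intro exI[of _ "padovan_word s @ [1]"] exI[of _ "[1, 0] @ padovan_tail t"])
      (simp add: padovan_word_def)
next
  assume "replace_one [0, 1] [1, 0] (padovan_word x) (padovan_word y)"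
  then obtain s t where u: "padovan_word x = s @ [0, 1] @ t" and v: "padovan_word y = s @ [1, 0] @ t"
    by (auto simp: replace_one_def)
  obtain s' t' where s: "s = s' @ [0, 1]" and t: "t = [1, 0] @ t'"
    using replace_one_padovan_context padovan_padovan_word u v by metis
  have u': "padovan_word x = s' @ 0 # [1, 0, 1, 1, 0] @ t'"
    using u s t by simp
  have "padovan (s' @ [0])"
    using padovan_appendD(1) padovan_padovan_word u' by metis
  then obtain xs where xs: "s' @ [0] = padovan_word xs"
    by (rule padovan_wordE)
  \<comment> \<open>The last 0 of the block 110 also serves as the initial 0 of the word coding the
    remaining letters.\<close>
  have "padovan_word x = (s' @ [0, 1, 0, 1, 1]) @ 0 # t'"
    using u' by simp
  then have "padovan (0 # t')"
    using padovan_appendD(2) padovan_padovan_word by metis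
  then obtain xt where xt: "0 # t' = padovan_word xt"
    by (rule padovan_wordE)
  have "padovan_word x = (s' @ [0]) @ [1, 0, 1, 1, 0] @ t'"
    using u' by simp
  also have "\<dots> = padovan_word (xs @ [LetterA, LetterB] @ xt)"
    unfolding xs using xt by (simp add: padovan_word_def)
  finally have "x = xs @ [LetterA, LetterB] @ xt"
    by simp
  moreover have "padovan_word y = (s' @ [0]) @ [1, 1, 0, 1, 0] @ t'"
    using v s t by simp
  then have "padovan_word y = padovan_word (xs @ [LetterB, LetterA] @ xt)"
    unfolding xs using xt by (simp add: padovan_word_def)
  then have "y = xs @ [LetterB, LetterA] @ xt"
    by simp
  ultimately show "replace_one [LetterA, LetterB] [LetterB, LetterA] x y"
    unfolding replace_one_def by blast
qed

lemma digraph_iso_ab_graph_padovan_graph: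
  "digraph_iso (with_proj (ab_graph p q)) (with_proj (padovan_graph (1 + 2 * p + 3 * q) (p + 2 * q)))"
  unfolding ab_graph_def padovan_graph_def
proof (rule digraph_iso_adj_graphI[where f = padovan_word])
  let ?V = "{x. length x = p + q \<and> count_list x LetterA = p \<and> count_list x LetterB = q}"
  let ?W = "{w. padovan w \<and> length w = 1 + 2 * p + 3 * q \<and> count_list w 1 = p + 2 * q}"
  have "?W \<subseteq> padovan_word ` ?V"
  proof
    fix w assume w: "w \<in> ?W"
    then obtain x where x: "w = padovan_word x"
      by (blast elim: padovan_wordE)
    with w have "x \<in> ?V"
      \<comment> \<open>Length and number of ones give a linear system with matrix rows (2,3) and
        (1,2) of determinant 1, so they determine both letter counts.\<close>
      using length_padovan_word[of x] count_padovan_word[of x] length_eq_count_ab[of x] by auto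
    with x show "w \<in> padovan_word ` ?V" by blast
  qed
  then show "bij_betw padovan_word ?V ?W"
    unfolding bij_betw_def
    by (auto simp: inj_on_def padovan_padovan_word length_padovan_word count_padovan_word)
qed (rule replace_one_padovan_word_iff)

section \<open>Partitions\<close>

fun partition_of :: "ab list \<Rightarrow> nat list" where
  "partition_of [] = []"
| "partition_of (LetterA # x) = partition_of x"
| "partition_of (LetterB # x) = count_list x LetterA # partition_of x"

text \<open>Inverse of \<open>partition_of\<close>: the first argument counts the letters a still to
  be placed, and each drop between successive parts is the run of a's before the next b.\<close>

fun word_of :: "nat \<Rightarrow> nat list \<Rightarrow> ab list" where
  "word_of p [] = replicate p LetterA"
| "word_of p (c # l) = replicate (p - c) LetterA @ LetterB # word_of c l"

lemma length_partition_of: "length (partition_of x) = count_list x LetterB"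
  by (induction x rule: partition_of.induct) auto

lemma partition_of_le: "c \<in> set (partition_of x) \<Longrightarrow> c \<le> count_list x LetterA"
  by (induction x rule: partition_of.induct) auto

lemma sorted_partition_of: "sorted_wrt (\<ge>) (partition_of x)"
  by (induction x rule: partition_of.induct) (auto dest: partition_of_le)

text \<open>Every a of \<open>t\<close> lies behind every b of \<open>s\<close>.\<close>

lemma partition_of_append:
  "partition_of (s @ t) = map (\<lambda>c. c + count_list t LetterA) (partition_of s) @ partition_of t"
  by (induction s rule: partition_of.induct) auto

lemma partition_of_replicate [simp]: "partition_of (replicate m LetterA @ t) = partition_of t"
  by (induction m) auto

lemma count_list_replicate_ab [simp]: "count_list (replicate m a) b = (if a = b then m else 0)"
  by (induction m) auto

lemma count_word_of:
  assumes "sorted_wrt (\<ge>) l" and "\<forall>x \<in> set l. x \<le> p"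
  shows "count_list (word_of p l) LetterA = p" and "count_list (word_of p l) LetterB = length l"
  using assms by (induction p l rule: word_of.induct) auto

lemma partition_of_word_of:
  assumes "sorted_wrt (\<ge>) l" and "\<forall>x \<in> set l. x \<le> p"
  shows "partition_of (word_of p l) = l"
  using assms
proof (induction p l rule: word_of.induct)
  case (1 p)
  show ?case using partition_of_replicate[of p "[]"] by simp
qed (auto simp: count_word_of)

text \<open>No part exceeds \<open>p\<close>, so the extra a lies behind no b and must come
  first.\<close>

lemma word_of_Suc:
  assumes "\<forall>x \<in> set l. x \<le> p"
  shows "word_of (Suc p) l = LetterA # word_of p l"
  using assms by (cases l) (auto simp: Suc_diff_le)

lemma word_of_partition_of: "word_of (count_list x LetterA) (partition_of x) = x"
  by (induction x rule: partition_of.induct) (auto simp: word_of_Suc partition_of_le)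

lemma replace_one_append: "replace_one x y u v \<Longrightarrow> replace_one x y (w @ u) (w @ v)"
  unfolding replace_one_def by (metis append.assoc)

text \<open>Parts before the changed one yield a common prefix. At the changed part, the run of a's
  before its b loses its last a, which reappears just behind that b.\<close>

lemma replace_one_word_of:
  assumes "sorted_wrt (\<ge>) (l @ c # m)" and "\<forall>x \<in> set (l @ Suc c # m). x \<le> p"
    and "sorted_wrt (\<ge>) (l @ Suc c # m)"
  shows "replace_one [LetterA, LetterB] [LetterB, LetterA]
    (word_of p (l @ c # m)) (word_of p (l @ Suc c # m))"
  using assms
proof (induction l arbitrary: p)
  case Nil
  then have "p - c = Suc (p - Suc c)"
    by auto
  then have "replicate (p - c) LetterA = replicate (p - Suc c) LetterA @ [LetterA]"
    by (simp add: replicate_append_same)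
  \<comment> \<open>Sortedness bounds the parts of \<open>m\<close> by \<open>c\<close>, so
    \<open>word_of (Suc c) m\<close> is \<open>word_of c m\<close> with one a in front.\<close>
  with Nil have
    "word_of p ([] @ c # m) = replicate (p - Suc c) LetterA @ [LetterA, LetterB] @ word_of c m"
    "word_of p ([] @ Suc c # m) = replicate (p - Suc c) LetterA @ [LetterB, LetterA] @ word_of c m"
    by (auto simp: word_of_Suc)
  then show ?case
    unfolding replace_one_def by blast
next
  case (Cons d l)
  then have "replace_one [LetterA, LetterB] [LetterB, LetterA]
      (word_of d (l @ c # m)) (word_of d (l @ Suc c # m))"
    by auto
  then have "replace_one [LetterA, LetterB] [LetterB, LetterA]
      ((replicate (p - d) LetterA @ [LetterB]) @ word_of d (l @ c # m))
      ((replicate (p - d) LetterA @ [LetterB]) @ word_of d (l @ Suc c # m))"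
    by (rule replace_one_append)
  then show ?case by simp
qed

text \<open>Recasts the indexed update as a change inside a fixed context, matching the shape of
  \<open>replace_one\<close>.\<close>

lemma add_one_iff: "add_one l m \<longleftrightarrow> (\<exists>s c t. l = s @ c # t \<and> m = s @ Suc c # t)"
proof
  assume "add_one l m"
  then obtain i where "i < length l" "m = l[i := Suc (l ! i)]"
    by (auto simp: add_one_def)
  then show "\<exists>s c t. l = s @ c # t \<and> m = s @ Suc c # t"
    by (metis id_take_nth_drop upd_conv_take_nth_drop)
next
  assume "\<exists>s c t. l = s @ c # t \<and> m = s @ Suc c # t"
  then obtain s c t where "l = s @ c # t" "m = s @ Suc c # t"
    by blast
  then show "add_one l m"
    unfolding add_one_def by (intro exI[of _ "length s"]) auto
qed

text \<open>\<open>partition_of\<close> forgets the a's before the first b; equal counts of a let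
  \<open>word_of\<close> recover both words from the same first argument.\<close>

lemma replace_one_partition_of_iff:
  assumes "count_list x LetterA = count_list y LetterA"
  shows "replace_one [LetterA, LetterB] [LetterB, LetterA] x y \<longleftrightarrow>
    add_one (partition_of x) (partition_of y)"
proof
  assume "replace_one [LetterA, LetterB] [LetterB, LetterA] x y"
  then obtain s t where "x = s @ [LetterA, LetterB] @ t" "y = s @ [LetterB, LetterA] @ t"
    by (auto simp: replace_one_def)
  then show "add_one (partition_of x) (partition_of y)"
    unfolding add_one_iff by (auto simp: partition_of_append)
next
  assume "add_one (partition_of x) (partition_of y)"
  then obtain s c t where eq: "partition_of x = s @ c # t" "partition_of y = s @ Suc c # t"
    by (auto simp: add_one_iff)
  then have "replace_one [LetterA, LetterB] [LetterB, LetterA]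
      (word_of (count_list x LetterA) (partition_of x)) (word_of (count_list x LetterA) (partition_of y))"
    using sorted_partition_of[of x] sorted_partition_of[of y] partition_of_le[of _ y]
    unfolding eq assms by (intro replace_one_word_of) auto
  then show "replace_one [LetterA, LetterB] [LetterB, LetterA] x y"
    using assms word_of_partition_of by metis
qed

lemma digraph_iso_ab_graph_partition_graph:
  "digraph_iso (with_proj (ab_graph p q)) (with_proj (partition_graph p q))"
  unfolding ab_graph_def partition_graph_def
proof (rule digraph_iso_adj_graphI[where f = partition_of])
  let ?V = "{x. length x = p + q \<and> count_list x LetterA = p \<and> count_list x LetterB = q}"
  let ?W = "{l. length l = q \<and> sorted_wrt (\<ge>) l \<and> (\<forall>x \<in> set l. x \<le> p)}"
  show "bij_betw partition_of ?V ?W"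
  proof (rule bij_betwI[where g = "word_of p"])
    show "partition_of \<in> ?V \<rightarrow> ?W"
      using sorted_partition_of by (auto simp: length_partition_of dest: partition_of_le)
    show "word_of p \<in> ?W \<rightarrow> ?V"
      by (auto simp: count_word_of length_eq_count_ab)
  qed (use word_of_partition_of partition_of_word_of in auto)
qed (simp add: replace_one_partition_of_iff)

theorem theorem2p6:
  fixes n k :: nat
  assumes "n \<ge> 1"
    and "n div 2 \<le> k"
    and "k \<le> (2 * n - 2) div 3"
  shows "digraph_iso (with_proj (padovan_graph n k)) (with_proj (ab_graph (2 * n - 3 * k - 2) (2 * k + 1 - n)))
    \<and> digraph_iso (with_proj (ab_graph (2 * n - 3 * k - 2) (2 * k + 1 - n)))
        (with_proj (partition_graph (2 * n - 3 * k - 2) (2 * k + 1 - n)))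
    \<and> digraph_iso (with_proj (padovan_graph n k))
        (with_proj (partition_graph (2 * n - 3 * k - 2) (2 * k + 1 - n)))"
proof -
  \<comment> \<open>Writing \<open>2 * k + 1 - n\<close> adds before the truncated subtraction, so
    the extreme case \<open>n = 2 * k + 1\<close> correctly gives 0.\<close>
  define p q where "p = 2 * n - 3 * k - 2" and "q = 2 * k + 1 - n"
  \<comment> \<open>The floor bounds become linear ones, using \<open>n \<ge> 1\<close> to keep
    \<open>2 * n - 2\<close> exact; then neither \<open>p\<close> nor \<open>q\<close> is
    truncated.\<close>
  have "3 * k + 2 \<le> 2 * n" and "n \<le> 2 * k + 1"
    using assms by linarith+
  then have n: "n = 1 + 2 * p + 3 * q" and k: "k = p + 2 * q"
    unfolding p_def q_def by linarith+
  \<comment> \<open>Reversing the isomorphism below requires its source, the ab-graph, to be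
    well-formed.\<close>
  interpret ab: pair_graph "ab_graph p q"
    by (rule pair_graph_ab_graph)
  have pad: "digraph_iso (with_proj (padovan_graph n k)) (with_proj (ab_graph p q))"
    unfolding n k
    by (rule digraph_iso_swap[OF _ digraph_iso_ab_graph_padovan_graph]) unfold_locales
  have part: "digraph_iso (with_proj (ab_graph p q)) (with_proj (partition_graph p q))"
    by (rule digraph_iso_ab_graph_partition_graph)
  from pad part digraph_iso_trans[OF pad part] show ?thesis
    unfolding p_def q_def by blast
qed

end
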